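(* Let $\kappa>0$ be a real number, let $\gamma$ be Euler's constant, and define $$g_{\kappa}(x):=e^{-e^{-[(\kappa-1)x+\kappa\gamma]}},\quad x\in\mathbb{R}.$$ (i) If $\kappa<1$, then $\inf_{x\in\mathbb{R}}g_{\kappa}(x)=\lim_{x\to\infty}g_{\kappa}(x)=0$. (ii) If $\kappa>1$, then $\inf_{x\in\mathbb{R}}g_{\kappa}(x)=\lim_{x\to-\infty}g_{\kappa}(x)=0$. (iii) If $\kappa=1$, then $g_{\kappa}(x)=e^{-e^{-\gamma}}>\frac12$ for all $x\in\mathbb{R}$.
   Context: $\gamma=\lim_{n\to\infty}\left(\sum_{k=1}^n\frac1k-\ln n\right)$ is Euler's constant. Origin of $g_\kappa$: if $X_{\mu,\beta}$ is a Gumbel random variable with parameters $\mu\in\mathbb{R},\beta>0$, i.e. with density $\frac1\beta e^{-z-e^{-z}}$, $z=\frac{x-\mu}{\beta}$, $x\in\mathbb{R}$, whose expectation is $\mu+\beta\gamma$, then $P(X_{\mu,\beta}\leq\kappa E[X_{\mu,\beta}])=g_\kappa(\mu/\beta)$. *)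

theory Defs
  imports "HOL-Analysis.Analysis"
begin

definition g :: "real \<Rightarrow> real \<Rightarrow> real" where
  "g \<kappa> x = exp (- exp (- ((\<kappa> - 1) * x + \<kappa> * euler_mascheroni)))"

text \<open>
  The infimum over the real line is always that of a nonempty set bounded below, so the
  conditionally complete \<^const>\<open>Inf\<close> on the reals is the genuine infimum here.
\<close>

lemma bdd_below_range_g: "bdd_below (range (g \<kappa>))"
  by (rule bdd_belowI[of _ 0]) (auto simp: g_def)

end

theory Submission
  imports Defs
begin

text \<open>The inner exponent is affine in \<open>x\<close> with slope \<open>1 - \<kappa>\<close>.
  If the slope is nonzero, it tends to infinity at one end of the line, so the double exponential
  tends to 0 there; as all values are nonnegative, this limit is also the infimum. If the slope
  vanishes, \<open>g\<close> is constant, and its value exceeds 1/2 because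
  \<open>exp (- \<gamma>) < ln 2\<close> for Euler's constant \<gamma>.\<close>

lemma INF_eq_lim_of_lower_bound:
  fixes f :: "'a \<Rightarrow> real"
  assumes "(f \<longlongrightarrow> l) F" and "F \<noteq> bot" and lower: "\<And>x. l \<le> f x"
  shows "(INF x\<in>UNIV. f x) = l"
proof (rule antisym)
  \<comment> \<open>\<open>cINF_lower\<close> needs this bound. The infimum then lies below every
    value of \<open>f\<close>, hence below the limit; \<open>F \<noteq> bot\<close> makes this
    passage valid.\<close>
  have "bdd_below (range f)"
    using lower by (intro bdd_belowI[of _ l]) auto
  then show "(INF x\<in>UNIV. f x) \<le> l"
    by (intro tendsto_lowerbound[OF assms(1) _ assms(2)] always_eventually allI cINF_lower) auto
  show "l \<le> (INF x\<in>UNIV. f x)"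
    using lower by (intro cINF_greatest) auto
qed

text \<open>Stating the hypothesis for an arbitrary filter treats both ends of the line at once: the
  sign of \<open>1 - \<kappa>\<close> decides which end satisfies it.\<close>

lemma tendsto_g_0:
  assumes "filterlim (\<lambda>x. (1 - \<kappa>) * x) at_top F"
  shows "(g \<kappa> \<longlongrightarrow> 0) F"
proof -
  have "filterlim (\<lambda>x. - \<kappa> * euler_mascheroni + (1 - \<kappa>) * x) at_top F"
    by (rule filterlim_tendsto_add_at_top[OF tendsto_const assms])
  then have "((\<lambda>x. exp (- exp (- \<kappa> * euler_mascheroni + (1 - \<kappa>) * x))) \<longlongrightarrow> 0) F"
    by (intro filterlim_compose[OF exp_at_bot] filterlim_compose[OF filterlim_uminus_at_bot_at_top]
        filterlim_compose[OF exp_at_top])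
  then show ?thesis
    unfolding g_def by (simp add: algebra_simps)
qed

text \<open>Since \<open>1/2 = exp (- ln 2)\<close>, the claim amounts to
  \<open>exp (- euler_mascheroni) < ln 2\<close>; the rational 2/3 separates the two sides.\<close>

lemma exp_minus_exp_minus_euler_mascheroni_gt_half:
  "exp (- exp (- euler_mascheroni)) > (1/2 :: real)"
proof -
  \<comment> \<open>3/2 is the reciprocal of the separating 2/3, and 19/33 > 1/2 suffices to exceed
    it.\<close>
  have "(3/2 :: real) < 1 + euler_mascheroni"
    using euler_mascheroni_gt_19_over_33 by simp
  also have "\<dots> \<le> exp euler_mascheroni"
    by (rule exp_ge_add_one_self)
  finally have "exp (- euler_mascheroni) < (2/3 :: real)"
    by (simp add: exp_minus field_simps)
  also have "\<dots> \<le> ln 2"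
    by (rule ln2_ge_two_thirds)
  finally have "exp (- ln 2) < exp (- exp (- euler_mascheroni :: real))"
    by simp
  then show ?thesis
    by (simp add: exp_minus)
qed

theorem proposition3p2:
  fixes \<kappa> :: real
  assumes "\<kappa> > 0"
  shows "(\<kappa> < 1 \<longrightarrow> (INF x\<in>UNIV. g \<kappa> x) = 0 \<and> (g \<kappa> \<longlongrightarrow> 0) at_top) \<and>
         (\<kappa> > 1 \<longrightarrow> (INF x\<in>UNIV. g \<kappa> x) = 0 \<and> (g \<kappa> \<longlongrightarrow> 0) at_bot) \<and>
         (\<kappa> = 1 \<longrightarrow> (\<forall>x. g \<kappa> x = exp (- exp (- euler_mascheroni)) \<and>
                          exp (- exp (- euler_mascheroni)) > (1/2 :: real)))"
proof (intro conjI impI allI)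
  have nonneg: "0 \<le> g \<kappa> x" for x
    by (simp add: g_def)
  show top: "(g \<kappa> \<longlongrightarrow> 0) at_top" if "\<kappa> < 1"
    using that
    by (intro tendsto_g_0 filterlim_tendsto_pos_mult_at_top[OF tendsto_const] filterlim_ident) simp
  show bot: "(g \<kappa> \<longlongrightarrow> 0) at_bot" if "\<kappa> > 1"
    using that
    by (intro tendsto_g_0 filterlim_tendsto_neg_mult_at_top_iff[OF tendsto_const, THEN iffD2]
        filterlim_ident) simp
  show "(INF x\<in>UNIV. g \<kappa> x) = 0" if "\<kappa> < 1"
    by (rule INF_eq_lim_of_lower_bound[OF top[OF that] _ nonneg]) simp
  show "(INF x\<in>UNIV. g \<kappa> x) = 0" if "\<kappa> > 1"
    by (rule INF_eq_lim_of_lower_bound[OF bot[OF that] _ nonneg]) simp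
  show "g \<kappa> x = exp (- exp (- euler_mascheroni))" if "\<kappa> = 1" for x
    using that by (simp add: g_def)
  show "exp (- exp (- euler_mascheroni)) > (1/2 :: real)"
    by (rule exp_minus_exp_minus_euler_mascheroni_gt_half)
qed

end
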